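(* Let $x\in\mathcal{B}^n$ and $x\in\mathcal{D}_n$. Then any closed max-min convex set $C\subseteq\mathcal{B}^n$ such that $x\notin C$ can be separated from $x$ by a max-min hyperplane, i.e. there exists a max-min hyperplane $H\subseteq\mathcal{B}^n$ with $C\subseteq H$ and $x\notin H$.
   Context: Let $n\ge 1$ and $\mathcal{B}=[0,1]$ with operations $\oplus=\max$ and $\wedge=\min$ ($\wedge$ has priority over $\oplus$). On $\mathcal{B}^n$, $(x\oplus y)_i=x_i\oplus y_i$ and, for a scalar $a\in\mathcal{B}$, $(a\wedge x)_i=a\wedge x_i$. Topological notions are those of $[0,1]^n\subset\mathbb{R}^n$. A subset $C\subseteq\mathcal{B}^n$ is max-min convex if $x,y\in C$, $\alpha,\beta\in\mathcal{B}$, $\alpha\oplus\beta=1$ imply $\alpha\wedge x\oplus\beta\wedge y\in C$. The diagonal of $\mathcal{B}^n$ is $\mathcal{D}_n=\{(a,\ldots,a)\mid a\in\mathcal{B}\}$. A max-min hyperplane is the set of all $x=(x_1,\ldots,x_n)\in\mathcal{B}^n$ satisfying an equation of the form $$a_1\wedge x_1\oplus\cdots\oplus a_n\wedge x_n\oplus a_{n+1}=b_1\wedge x_1\oplus\cdots\oplus b_n\wedge x_n\oplus b_{n+1},$$ with $a_k,b_k\in\mathcal{B}$ for $k=1,\ldots,n+1$, where each side contains at least one term (omitting a term amounts to its coefficient being $0$). *)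

theory Defs
  imports "HOL-Analysis.Analysis"
begin

definition mm_cube :: "(real ^ 'n) set" where
  "mm_cube = {x. \<forall>i. x $ i \<in> {0..1}}"

definition mm_add :: "real ^ 'n \<Rightarrow> real ^ 'n \<Rightarrow> real ^ 'n" where
  "mm_add x y = (\<chi> i. max (x $ i) (y $ i))"

definition mm_scale :: "real \<Rightarrow> real ^ 'n \<Rightarrow> real ^ 'n" where
  "mm_scale a x = (\<chi> i. min a (x $ i))"

definition mm_convex :: "(real ^ 'n) set \<Rightarrow> bool" where
  "mm_convex C \<longleftrightarrow> C \<subseteq> mm_cube \<and>
     (\<forall>x\<in>C. \<forall>y\<in>C. \<forall>\<alpha>\<in>{0..1}. \<forall>\<beta>\<in>{0..1}. max \<alpha> \<beta> = 1 \<longrightarrow>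
        mm_add (mm_scale \<alpha> x) (mm_scale \<beta> y) \<in> C)"

definition mm_diagonal :: "(real ^ 'n) set" where
  "mm_diagonal = {(\<chi> i. a) | a. a \<in> {0..1}}"

definition mm_affine :: "real ^ 'n \<Rightarrow> real \<Rightarrow> real ^ 'n \<Rightarrow> real" where
  "mm_affine a c x = max (MAX i\<in>UNIV. min (a $ i) (x $ i)) c"

text \<open>An omitted term has coefficient 0, the neutral element of the maximum on the unit interval,
  so the requirement that each side contain at least one term places no condition
  on the coefficients.  Degenerate equations are not excluded, so the empty set and the whole cube
  are hyperplanes.\<close>

definition mm_hyperplane :: "(real ^ 'n) set \<Rightarrow> bool" where
  "mm_hyperplane H \<longleftrightarrow>
     (\<exists>a\<in>mm_cube. \<exists>b\<in>mm_cube. \<exists>c\<in>{0..1}. \<exists>d\<in>{0..1}.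
        H = {x \<in> mm_cube. mm_affine a c x = mm_affine b d x})"

end

theory Submission
  imports Defs
begin

text \<open>Let \<open>x = (t, \<dots>, t)\<close>. Two kinds of sets are max-min hyperplanes even though they look like
  half-spaces: the points of the cube with some coordinate at least \<open>s\<close>
  (\<open>mm_hyperplane_some_coordinate_ge\<close>), and those with one fixed coordinate at most \<open>s\<close>
  (\<open>mm_hyperplane_coordinate_le\<close>).
  Compactness of a nonempty \<open>C\<close> turns a strict inequality on \<open>C\<close> into a threshold \<open>s \<noteq> t\<close>.

  If every point of \<open>C\<close> has a coordinate above \<open>t\<close>, the first kind separates. Otherwise \<open>C\<close> contains
  some \<open>z \<le> x\<close>. If \<open>C\<close> also had, for each \<open>i\<close>, a point whose \<open>i\<close>-th coordinate reaches \<open>t\<close>,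
  then cutting these points at level \<open>t\<close> and adding them to \<open>z\<close> would produce \<open>x\<close> itself
  (\<open>mm_convex_diagonal_point\<close>). So some coordinate stays below \<open>t\<close> on \<open>C\<close>, and
  the second kind separates.\<close>

lemma compact_mm_cube: "compact (mm_cube :: (real ^ 'n) set)"
proof -
  have "(mm_cube :: (real ^ 'n) set) = cbox 0 1"
    by (auto simp: mm_cube_def mem_box_cart)
  then show ?thesis
    by (metis compact_cbox)
qed

lemma continuous_on_Max_image:
  fixes f :: "'i \<Rightarrow> 'a :: topological_space \<Rightarrow> 'b :: linorder_topology"
  assumes "finite I" "I \<noteq> {}" "\<And>i. i \<in> I \<Longrightarrow> continuous_on S (f i)"
  shows "continuous_on S (\<lambda>x. MAX i\<in>I. f i x)"
  using assms by (induction I rule: finite_ne_induct) (auto intro: continuous_on_max)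

text \<open>The equation is \<open>max\<^sub>i min s y\<^sub>i = s\<close>: cutting at \<open>s\<close> makes the left side at most \<open>s\<close>
  everywhere, so only the lower bound is a condition.\<close>

lemma mm_hyperplane_some_coordinate_ge:
  assumes s: "s \<in> {0..1}"
  shows "mm_hyperplane {y \<in> mm_cube. \<exists>i :: 'n :: finite. s \<le> y $ i}"
proof -
  have "mm_affine (\<chi> i. s) 0 y = mm_affine 0 s y \<longleftrightarrow> (\<exists>i. s \<le> y $ i)"
    if y: "y \<in> mm_cube" for y :: "real ^ 'n"
  proof -
    have nonneg: "0 \<le> y $ i" for i
      using y by (simp add: mm_cube_def)
    have left: "mm_affine (\<chi> i. s) 0 y = (MAX i\<in>UNIV. min s (y $ i))"
      using nonneg s unfolding mm_affine_def by (auto intro!: max_absorb1 simp: Max_ge_iff)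
    have "mm_affine 0 s y = s"
      using nonneg s by (simp add: mm_affine_def)
    moreover have "(MAX i\<in>UNIV. min s (y $ i)) = s \<longleftrightarrow> (\<exists>i. s \<le> y $ i)"
      by (subst Max_eq_iff) (auto simp: min_def)
    ultimately show ?thesis
      using left by simp
  qed
  then have "{y \<in> mm_cube. \<exists>i :: 'n. s \<le> y $ i} =
      {y \<in> mm_cube. mm_affine (\<chi> i. s) 0 y = mm_affine 0 s y}"
    by blast
  moreover have "(\<chi> i. s) \<in> (mm_cube :: (real ^ 'n) set)" "0 \<in> (mm_cube :: (real ^ 'n) set)"
    using s by (auto simp: mm_cube_def)
  ultimately show ?thesis
    unfolding mm_hyperplane_def using s
    by (intro bexI[where x = "\<chi> i. s"] bexI[where x = 0] bexI[where x = s]) auto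
qed

text \<open>The equation is \<open>max y\<^sub>i s = s\<close>, with the unit vector at \<open>i\<close> selecting the coordinate.\<close>

lemma mm_hyperplane_coordinate_le:
  fixes i :: "'n :: finite"
  assumes s: "s \<in> {0..1}"
  shows "mm_hyperplane {y \<in> mm_cube. y $ i \<le> s}"
proof -
  have "mm_affine (axis i 1) s y = mm_affine 0 s y \<longleftrightarrow> y $ i \<le> s"
    if y: "y \<in> mm_cube" for y :: "real ^ 'n"
  proof -
    have y01: "0 \<le> y $ j" "y $ j \<le> 1" for j
      using y by (simp_all add: mm_cube_def)
    have "(MAX j\<in>UNIV. min (axis i 1 $ j) (y $ j)) = y $ i"
      by (rule Max_eqI) (use y01 in \<open>auto simp: axis_def image_iff intro!: exI[of _ i]\<close>)
    then have "mm_affine (axis i 1) s y = max (y $ i) s"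
      by (simp add: mm_affine_def)
    moreover have "mm_affine 0 s y = s"
      using y01 s by (simp add: mm_affine_def)
    ultimately show ?thesis
      by auto
  qed
  then have "{y \<in> mm_cube. y $ i \<le> s} =
      {y \<in> mm_cube. mm_affine (axis i 1) s y = mm_affine 0 s y}"
    by blast
  moreover have "axis i 1 \<in> (mm_cube :: (real ^ 'n) set)" "0 \<in> (mm_cube :: (real ^ 'n) set)"
    by (auto simp: mm_cube_def axis_def)
  ultimately show ?thesis
    unfolding mm_hyperplane_def using s by blast
qed

text \<open>The constant sides \<open>0\<close> and \<open>1\<close> never agree; this separates an empty \<open>C\<close>.\<close>

lemma mm_hyperplane_empty: "mm_hyperplane ({} :: (real ^ 'n) set)"
proof -
  have "mm_affine 0 0 y \<noteq> mm_affine 0 1 y" if "y \<in> mm_cube" for y :: "real ^ 'n"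
    using that by (simp add: mm_affine_def mm_cube_def)
  then have "{} = {y \<in> mm_cube :: (real ^ 'n) set. mm_affine 0 0 y = mm_affine 0 1 y}"
    by blast
  moreover have "0 \<in> (mm_cube :: (real ^ 'n) set)"
    by (simp add: mm_cube_def)
  ultimately show ?thesis
    unfolding mm_hyperplane_def
    by (intro bexI[where x = 0] bexI[where x = 1]) auto
qed

text \<open>Points of \<open>C\<close> may be cut at level \<open>t\<close> before they are added to \<open>z\<close>, because \<open>z\<close> keeps the
  coefficient 1 that a max-min convex combination needs. Each addition raises one more
  coordinate to \<open>t\<close>, and none exceeds it.\<close>

lemma mm_convex_diagonal_point:
  fixes z :: "real ^ 'n"
  assumes C: "mm_convex C" and t: "t \<in> {0..1}"
    and z: "z \<in> C" "\<And>j. z $ j \<le> t"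
    and reach: "\<And>i. \<exists>y\<in>C. t \<le> y $ i"
  shows "(\<chi> i. t) \<in> C"
proof -
  have "\<exists>w\<in>C. (\<forall>j. w $ j \<le> t) \<and> (\<forall>j\<in>J. w $ j = t)" if "finite J" for J
    using that
  proof induction
    case empty
    then show ?case
      using z by blast
  next
    case (insert i J)
    obtain w where w: "w \<in> C" "\<And>j. w $ j \<le> t" "\<And>j. j \<in> J \<Longrightarrow> w $ j = t"
      using insert.IH by blast
    obtain y where y: "y \<in> C" "t \<le> y $ i"
      using reach by blast
    let ?v = "mm_add (mm_scale 1 w) (mm_scale t y)"
    have "w $ j \<le> 1" for j
      using C w(1) by (auto simp: mm_convex_def mm_cube_def)
    then have v: "?v $ j = max (w $ j) (min t (y $ j))" for j
      by (simp add: mm_add_def mm_scale_def)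
    have "?v \<in> C"
      using C w(1) y(1) t unfolding mm_convex_def by auto
    moreover have "?v $ j \<le> t" for j
      using w(2) by (simp add: v)
    moreover have "?v $ j = t" if "j \<in> insert i J" for j
      using that w(2)[of j] w(3)[of j] y(2) by (auto simp: v)
    ultimately show ?case
      by blast
  qed
  from this[of UNIV] obtain w where "w \<in> C" "\<And>j. w $ j = t"
    by auto
  moreover from this have "w = (\<chi> i. t)"
    by (simp add: vec_eq_iff)
  ultimately show ?thesis
    by simp
qed

theorem corollary3p4:
  fixes x :: "real ^ 'n" and C :: "(real ^ 'n) set"
  assumes "x \<in> mm_cube"
    and "x \<in> mm_diagonal"
    and "C \<subseteq> mm_cube"
    and "closedin (top_of_set mm_cube) C"
    and "mm_convex C"
    and "x \<notin> C"
  shows "\<exists>H. mm_hyperplane H \<and> H \<subseteq> mm_cube \<and> C \<subseteq> H \<and> x \<notin> H"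
proof -
  obtain t where t: "t \<in> {0..1}" and x: "x = (\<chi> i. t)"
    using assms(2) by (auto simp: mm_diagonal_def)
  have "compact C"
    using compact_mm_cube assms(4) by (rule closedin_compact)
  have C01: "y $ i \<in> {0..1}" if "y \<in> C" for y i
    using assms(3) that by (auto simp: mm_cube_def)
  consider (empty) "C = {}" | (above) "C \<noteq> {}" "\<And>y. y \<in> C \<Longrightarrow> \<exists>i. t < y $ i"
    | (below) z where "z \<in> C" "\<And>i. z $ i \<le> t"
    by (meson not_le)
  then show ?thesis
  proof cases
    case empty
    then show ?thesis
      using mm_hyperplane_empty by blast
  next
    case above
    have "continuous_on C (\<lambda>y. MAX i\<in>UNIV. y $ i)"
      by (intro continuous_on_Max_image continuous_intros) auto
    then obtain m where m: "m \<in> C"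
      "\<And>y. y \<in> C \<Longrightarrow> (MAX i\<in>UNIV. m $ i) \<le> (MAX i\<in>UNIV. y $ i)"
      using continuous_attains_inf[OF \<open>compact C\<close> above(1)] by blast
    define s where "s = (MAX i\<in>UNIV. m $ i)"
    have "s \<in> range (($) m)"
      unfolding s_def by (rule Max_in) auto
    then have "s \<in> {0..1}"
      using C01[OF m(1)] by auto
    have "t < s"
      using above(2)[OF m(1)] by (auto simp: s_def Max_gr_iff)
    let ?H = "{y \<in> mm_cube. \<exists>i. s \<le> y $ i}"
    have "mm_hyperplane ?H"
      using \<open>s \<in> {0..1}\<close> by (rule mm_hyperplane_some_coordinate_ge)
    moreover have "\<exists>i. s \<le> y $ i" if "y \<in> C" for y
      using m(2)[OF that, folded s_def] by (simp add: Max_ge_iff)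
    then have "C \<subseteq> ?H"
      using assms(3) by blast
    moreover have "x \<notin> ?H"
      using \<open>t < s\<close> by (simp add: x)
    ultimately show ?thesis
      by blast
  next
    case (below z)
    have "\<exists>i. \<forall>y\<in>C. y $ i < t"
      using mm_convex_diagonal_point[OF assms(5) t below] assms(6) x by (meson not_le)
    then obtain i where i: "\<And>y. y \<in> C \<Longrightarrow> y $ i < t"
      by blast
    have "continuous_on C (\<lambda>y. y $ i)"
      by (intro continuous_intros)
    then obtain m where m: "m \<in> C" "\<And>y. y \<in> C \<Longrightarrow> y $ i \<le> m $ i"
      using continuous_attains_sup[OF \<open>compact C\<close>] below(1) by blast
    let ?H = "{y \<in> mm_cube. y $ i \<le> m $ i}"
    have "mm_hyperplane ?H"
      using C01[OF m(1)] by (rule mm_hyperplane_coordinate_le)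
    moreover have "C \<subseteq> ?H"
      using assms(3) m(2) by auto
    moreover have "x \<notin> ?H"
      using i[OF m(1)] by (simp add: x)
    ultimately show ?thesis
      by blast
  qed
qed

end
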